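(* Let $S=\{0,1,\dots,40\}$ and $S'=\{0',1',\dots,40'\}$ be disjoint. The following base blocks generate (under addition modulo $41$) a CURD with $\lambda=1$, on the $n=82$ varieties $S\cup S'$, with partition $10^1 2^{36}$: - the block of size $10$: $\{1,10,16,18,37,2',20',36',32',33'\}$; - blocks within $S$: $\{5,6\}$, $\{9,19\}$, $\{39,14\}$, $\{8,26\}$, $\{21,17\}$, $\{31,38\}$, $\{23,11\}$, $\{4,34\}$, $\{25,28\}$, $\{40,12\}$; - blocks within $S'$: $\{10',12'\}$, $\{18',38'\}$, $\{37',28'\}$, $\{16',11'\}$, $\{1',34'\}$, $\{21',35'\}$, $\{5',22'\}$, $\{8',27'\}$, $\{9',15'\}$, $\{39',24'\}$; - blocks between $S$ and $S'$: $\{2,30'\}$, $\{20,13'\}$, $\{36,7'\}$, $\{32,29'\}$, $\{33,3'\}$, $\{15,23'\}$, $\{27,25'\}$, $\{24,4'\}$, $\{35,40'\}$, $\{22,31'\}$, $\{3,6'\}$, $\{30,19'\}$, $\{13,26'\}$, $\{7,14'\}$, $\{29,17'\}$, $\{0,0'\}$.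
   Context: For $j\in\{0,\dots,40\}$, adding $j$ to an element of $S\cup S'$ means $i\mapsto i+j \pmod{41}$ on $S$ and $i'\mapsto (i+j \bmod 41)'$ on $S'$. The base blocks generate the design whose parallel classes are indexed by $j=0,1,\dots,40$, the $j$-th parallel class consisting of all base blocks with $j$ added to every element. A pairwise balanced design with index $\lambda$ is a pair $(X,\mathcal B)$ of a finite set $X$ of varieties and a collection $\mathcal B$ of subsets of $X$ (blocks) such that each pair of distinct varieties appears together in exactly $\lambda$ blocks. It is a Class-Uniformly Resolvable Design (CURD) if $\mathcal B$ is partitioned into parallel classes, each of which contains each variety exactly once, and all parallel classes have the same block sizes (with multiplicity). Partition $10^1 2^{36}$ means that each parallel class consists of exactly one block of size $10$ and thirty-six blocks of size $2$. *)

theory Defs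
  imports Main "HOL-Library.Multiset"
begin

text \<open>Collections of blocks are multisets of sets: for a general index a block may be repeated.\<close>

definition pbd :: "'a set \<Rightarrow> 'a set multiset \<Rightarrow> nat \<Rightarrow> bool" where
  "pbd X B lam \<longleftrightarrow>
     finite X \<and>
     (\<forall>b \<in># B. b \<subseteq> X) \<and>
     (\<forall>x \<in> X. \<forall>y \<in> X. x \<noteq> y \<longrightarrow> size {#b \<in># B. x \<in> b \<and> y \<in> b#} = lam)"

definition parallel_class :: "'a set \<Rightarrow> 'a set multiset \<Rightarrow> bool" where
  "parallel_class X P \<longleftrightarrow>
     (\<forall>b \<in># P. b \<subseteq> X) \<and> (\<forall>x \<in> X. size {#b \<in># P. x \<in> b#} = 1)"

text \<open>The partition of the blocks into parallel classes is carried explicitly, as the multiset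
  \<open>R\<close> of its classes. That \<open>R\<close> partitions \<open>B\<close> (with multiplicities) is \<open>\<Sum>\<^sub># R = B\<close> together with
  the nonemptiness of each class.\<close>

definition curd :: "'a set \<Rightarrow> 'a set multiset \<Rightarrow> 'a set multiset multiset \<Rightarrow> nat \<Rightarrow> bool" where
  "curd X B R lam \<longleftrightarrow>
     pbd X B lam \<and>
     \<Sum>\<^sub># R = B \<and>
     (\<forall>P \<in># R. P \<noteq> {#} \<and> parallel_class X P) \<and>
     (\<forall>P \<in># R. \<forall>Q \<in># R. image_mset card P = image_mset card Q)"

text \<open>The partition type \<open>k\<^sub>1\<^bsup>m\<^sub>1\<^esup> k\<^sub>2\<^bsup>m\<^sub>2\<^esup> \<dots>\<close> is the multiset with \<open>m\<^sub>i\<close> copies of \<open>k\<^sub>i\<close>.\<close>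

definition has_partition_type :: "'a set multiset multiset \<Rightarrow> nat multiset \<Rightarrow> bool" where
  "has_partition_type R \<tau> \<longleftrightarrow> (\<forall>P \<in># R. image_mset card P = \<tau>)"

text \<open>\<open>Inl i\<close> is the element \<open>i\<close> of \<open>S\<close> and \<open>Inr i\<close> is the element \<open>i'\<close> of \<open>S'\<close>.\<close>

type_synonym variety = "nat + nat"

definition varieties :: "variety set" where
  "varieties = Inl ` {0..40} \<union> Inr ` {0..40}"

definition shift :: "nat \<Rightarrow> variety \<Rightarrow> variety" where
  "shift j = map_sum (\<lambda>i. (i + j) mod 41) (\<lambda>i. (i + j) mod 41)"

definition shifted_class :: "variety set multiset \<Rightarrow> nat \<Rightarrow> variety set multiset" where
  "shifted_class A j = image_mset (\<lambda>b. shift j ` b) A"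

definition generated_classes :: "variety set multiset \<Rightarrow> variety set multiset multiset" where
  "generated_classes A = image_mset (shifted_class A) (mset_set {0..40})"

definition generated_blocks :: "variety set multiset \<Rightarrow> variety set multiset" where
  "generated_blocks A = (\<Sum>j \<in> {0..40}. shifted_class A j)"

definition base_blocks :: "variety set multiset" where
  "base_blocks =
    {# {Inl 1, Inl 10, Inl 16, Inl 18, Inl 37, Inr 2, Inr 20, Inr 36, Inr 32, Inr 33} #} +
    {# {Inl 5, Inl 6}, {Inl 9, Inl 19}, {Inl 39, Inl 14}, {Inl 8, Inl 26}, {Inl 21, Inl 17},
       {Inl 31, Inl 38}, {Inl 23, Inl 11}, {Inl 4, Inl 34}, {Inl 25, Inl 28}, {Inl 40, Inl 12} #} +
    {# {Inr 10, Inr 12}, {Inr 18, Inr 38}, {Inr 37, Inr 28}, {Inr 16, Inr 11}, {Inr 1, Inr 34},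
       {Inr 21, Inr 35}, {Inr 5, Inr 22}, {Inr 8, Inr 27}, {Inr 9, Inr 15}, {Inr 39, Inr 24} #} +
    {# {Inl 2, Inr 30}, {Inl 20, Inr 13}, {Inl 36, Inr 7}, {Inl 32, Inr 29}, {Inl 33, Inr 3},
       {Inl 15, Inr 23}, {Inl 27, Inr 25}, {Inl 24, Inr 4}, {Inl 35, Inr 40}, {Inl 22, Inr 31},
       {Inl 3, Inr 6}, {Inl 30, Inr 19}, {Inl 13, Inr 26}, {Inl 7, Inr 14}, {Inl 29, Inr 17},
       {Inl 0, Inr 0} #}"

end

theory Submission
  imports Defs "HOL-Library.Code_Binary_Nat" "HOL-Number_Theory.Cong"
begin

text \<open>Bose's method of differences. A base block \<open>b\<close> has a translate containing two given
  varieties \<open>x, y\<close> once for every ordered pair of its elements that has the same sides and the same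
  difference modulo 41 as \<open>(x, y)\<close>. So the index is 1 as soon as every such type occurs exactly once
  among all pairs of elements of the base blocks, which is a finite check. Translation permutes the
  varieties, so all translates are parallel classes with equal block sizes because the base blocks
  partition the varieties.\<close>

section \<open>Differences and residue arithmetic\<close>

fun value_of :: "variety \<Rightarrow> nat" where
  "value_of (Inl i) = i"
| "value_of (Inr i) = i"

text \<open>Translation preserves the side of each entry and the residue of the second value minus
  the first. Adding 41 first keeps the subtraction of naturals from truncating.\<close>

definition difference :: "variety \<Rightarrow> variety \<Rightarrow> bool \<times> bool \<times> nat" where
  "difference x y = (isl x, isl y, (value_of y + 41 - value_of x) mod 41)"

lemma add_mod_eq: "(m + n) mod k = (if m + n < k then m + n else m + n - k)"
  if "m < k" "n < k" for m n k :: nat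
  using that by (simp add: mod_if)

lemma diff_mod_eq: "(b + k - a) mod k = (if a \<le> b then b - a else b + k - a)"
  if "a < k" "b < k" for a b k :: nat
  using that by (auto simp: mod_if)

text \<open>Modulo \<open>k\<close> the only solution is the residue of \<open>c - a\<close>.
  Keeping \<open>j < k\<close> on the left turns the condition on \<open>j\<close> into an equation,
  usable for rewriting sets of shifts.\<close>

lemma translation_unique: "j < k \<and> (a + j) mod k = c \<longleftrightarrow> j = (c + k - a) mod k"
  if "a < k" "c < k" for a c j k :: nat
  using that by (cases "j < k") (auto simp: add_mod_eq diff_mod_eq)

text \<open>The shift taking \<open>a\<close> to \<open>c\<close> takes \<open>b\<close> to
  \<open>d\<close> iff c - a = d - b modulo \<open>k\<close>, and this rearranges to b - a = d -
  c.\<close>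

lemma translation_difference:
  "(b + (c + k - a) mod k) mod k = d \<longleftrightarrow> (b + k - a) mod k = (d + k - c) mod k"
  if "a < k" "b < k" "c < k" "d < k" for a b c d k :: nat
proof -
  have "(b + (c + k - a) mod k) mod k = d \<longleftrightarrow> (c + k - a) mod k = (d + k - b) mod k"
    using translation_unique[of b k d "(c + k - a) mod k"] that by auto
  also have "\<dots> \<longleftrightarrow> (b + k - a) mod k = (d + k - c) mod k"
    using that by (auto simp: diff_mod_eq)
  finally show ?thesis .
qed

section \<open>Translations permute the varieties\<close>

lemma in_varieties_iff: "x \<in> varieties \<longleftrightarrow> value_of x < 41"
  by (cases x) (auto simp: varieties_def)

text \<open>Cancelling \<open>j\<close> gives congruence modulo 41, which is equality only for
  values below 41; on all naturals i and i + 41 would collide.\<close>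

lemma inj_on_shift: "inj_on (shift j) varieties"
proof (rule inj_onI)
  have *: "a = c" if "(a + j) mod 41 = (c + j) mod 41" "a < 41" "c < 41" for a c :: nat
  proof -
    have "[a = c] (mod 41)"
      using that(1) unfolding cong_def[symmetric] by (simp only: cong_add_rcancel_nat)
    then show ?thesis
      using that by (simp add: cong_def)
  qed
  fix x y assume "x \<in> varieties" "y \<in> varieties" "shift j x = shift j y"
  then show "x = y"
    by (cases x; cases y) (auto simp: in_varieties_iff shift_def intro: *)
qed

lemma shift_in_varieties: "shift j x \<in> varieties"
  by (cases x) (auto simp: in_varieties_iff shift_def)

lemma finite_varieties: "finite varieties"
  by (simp add: varieties_def)

lemma shift_image_varieties: "shift j ` varieties = varieties"
  by (rule endo_inj_surj) (auto simp: finite_varieties inj_on_shift shift_in_varieties)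

section \<open>Translates through a given pair\<close>

lemma card_shifts_of_pair:
  assumes "p \<in> varieties" "q \<in> varieties" "x \<in> varieties" "y \<in> varieties"
  shows "card {j \<in> {0..40}. shift j p = x \<and> shift j q = y} =
    (if difference p q = difference x y then 1 else 0)"
proof -
  have *: "card {j \<in> {0..40}. (a + j) mod 41 = c \<and> (b + j) mod 41 = d} =
      (if (b + 41 - a) mod 41 = (d + 41 - c) mod 41 then 1 else 0)"
    if less: "a < 41" "b < 41" "c < 41" "d < 41" for a b c d :: nat
  proof -
    have "{j \<in> {0..40}. (a + j) mod 41 = c \<and> (b + j) mod 41 = d} =
        {j. (j < 41 \<and> (a + j) mod 41 = c) \<and> (b + j) mod 41 = d}"
      by auto
    \<comment> \<open>The first condition leaves a single candidate for \<open>j\<close>; the second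
      only keeps or rejects it.\<close>
    also have "\<dots> = {j. j = (c + 41 - a) mod 41 \<and> (b + j) mod 41 = d}"
      unfolding translation_unique[OF less(1,3)] ..
    also have "\<dots> = (if (b + 41 - a) mod 41 = (d + 41 - c) mod 41 then {(c + 41 - a) mod 41} else {})"
      using translation_difference[OF less] by auto
    finally show ?thesis by simp
  qed
  show ?thesis
    \<comment> \<open>If the sides of \<open>p\<close> and \<open>x\<close>, or of \<open>q\<close>
      and \<open>y\<close>, disagree, no shift works and the differences disagree as well.\<close>
    using assms
    by (cases p; cases q; cases x; cases y) (simp_all add: in_varieties_iff shift_def difference_def *
        del: atLeastAtMost_iff)
qed

text \<open>Each counted shift comes from exactly one ordered pair of preimages in \<open>b\<close>,
  as \<open>shift j\<close> is injective there, so the shifts split into disjoint sets indexed by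
  pairs.\<close>

lemma card_shifts_of_block:
  assumes b: "b \<subseteq> varieties" and x: "x \<in> varieties" and y: "y \<in> varieties"
  shows "card {j \<in> {0..40}. x \<in> shift j ` b \<and> y \<in> shift j ` b} =
    card {(p, q) \<in> b \<times> b. difference p q = difference x y}"
proof -
  let ?J = "\<lambda>p q. {j \<in> {0..40}. shift j p = x \<and> shift j q = y}"
  have fin: "finite b"
    using b finite_varieties finite_subset by blast
  have "{j \<in> {0..40}. x \<in> shift j ` b \<and> y \<in> shift j ` b} = (\<Union>(p, q) \<in> b \<times> b. ?J p q)"
    by auto
  also have "card \<dots> = (\<Sum>pq \<in> b \<times> b. card (case pq of (p, q) \<Rightarrow> ?J p q))"
  proof (rule card_UN_disjoint)
    have "p = p'" if "p \<in> b" "p' \<in> b" "shift j p = shift j p'" for j p p'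
      using that b inj_onD[OF inj_on_shift] by blast
    then show "\<forall>r \<in> b \<times> b. \<forall>s \<in> b \<times> b. r \<noteq> s \<longrightarrow>
        (case r of (p, q) \<Rightarrow> ?J p q) \<inter> (case s of (p, q) \<Rightarrow> ?J p q) = {}"
      by fastforce
  qed (use fin in auto)
  also have "\<dots> = (\<Sum>(p, q) \<in> b \<times> b. if difference p q = difference x y then 1 else 0)"
    using b x y by (intro sum.cong) (auto simp: card_shifts_of_pair subset_iff simp del: atLeastAtMost_iff)
  also have "\<dots> = card {(p, q) \<in> b \<times> b. difference p q = difference x y}"
  proof -
    have "{(p, q) \<in> b \<times> b. difference p q = difference x y} =
        {pq \<in> b \<times> b. case pq of (p, q) \<Rightarrow> difference p q = difference x y}"
      by auto
    then show ?thesis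
      using sum.inter_filter[of "b \<times> b" "\<lambda>_. 1 :: nat"
          "\<lambda>pq. case pq of (p, q) \<Rightarrow> difference p q = difference x y"] fin
      by (simp add: split_def)
  qed
  finally show ?thesis .
qed

text \<open>Double counting: the blocks are generated shift by shift, but are counted here base
  block by base block.\<close>

lemma size_filter_generated_blocks:
  assumes A: "\<forall>b \<in># A. b \<subseteq> varieties" and xy: "x \<in> varieties" "y \<in> varieties"
  shows "size {#b \<in># generated_blocks A. x \<in> b \<and> y \<in> b#} =
    (\<Sum>b \<in># A. card {(p, q) \<in> b \<times> b. difference p q = difference x y})"
proof -
  have "size {#b \<in># generated_blocks A. x \<in> b \<and> y \<in> b#} =
      (\<Sum>b \<in># A. card {j \<in> {0..40}. x \<in> shift j ` b \<and> y \<in> shift j ` b})"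
  proof (induction A)
    case empty
    then show ?case by (simp add: generated_blocks_def shifted_class_def)
  next
    case (add b A)
    have split: "generated_blocks (add_mset b A) =
        (\<Sum>j \<in> {0..40}. {#shift j ` b#}) + generated_blocks A"
      by (simp add: generated_blocks_def shifted_class_def flip: sum.distrib)
    \<comment> \<open>The range of shifts is generalised to any finite \<open>J\<close> to allow
      induction.\<close>
    have "size {#c \<in># (\<Sum>j \<in> J. {#shift j ` b#}). x \<in> c \<and> y \<in> c#} =
        card {j \<in> J. x \<in> shift j ` b \<and> y \<in> shift j ` b}" if "finite J" for J
      using that
    proof (induction J)
      case (insert i J)
      have "{j \<in> insert i J. Q j} = (if Q i then insert i {j \<in> J. Q j} else {j \<in> J. Q j})" for Q
        by auto
      with insert show ?case by simp
    qed simp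
    with add split show ?case by simp
  qed
  also have "\<dots> = (\<Sum>b \<in># A. card {(p, q) \<in> b \<times> b. difference p q = difference x y})"
    using A xy by (intro arg_cong[of _ _ sum_mset] image_mset_cong card_shifts_of_block) auto
  finally show ?thesis .
qed

section \<open>Translated parallel classes\<close>

lemma parallel_class_shifted_class:
  assumes "parallel_class varieties A"
  shows "parallel_class varieties (shifted_class A j)"
  unfolding parallel_class_def
proof (intro conjI ballI)
  fix b assume "b \<in># shifted_class A j"
  then show "b \<subseteq> varieties"
    by (auto simp: shifted_class_def shift_in_varieties)
next
  fix x assume "x \<in> varieties"
  then obtain y where y: "y \<in> varieties" "x = shift j y"
    using shift_image_varieties by blast
  have "x \<in> shift j ` b \<longleftrightarrow> y \<in> b" if "b \<in># A" for b
    using that y assms inj_on_image_mem_iff[OF inj_on_shift] by (simp add: parallel_class_def)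
  then have "{#b \<in># A. x \<in> shift j ` b#} = {#b \<in># A. y \<in> b#}"
    by (intro filter_mset_cong) auto
  then show "size {#b \<in># shifted_class A j. x \<in> b#} = 1"
    using assms y by (simp add: shifted_class_def parallel_class_def filter_mset_image_mset)
qed

lemma image_mset_card_shifted_class:
  assumes "\<forall>b \<in># A. b \<subseteq> varieties"
  shows "image_mset card (shifted_class A j) = image_mset card A"
proof -
  have "card (shift j ` b) = card b" if "b \<in># A" for b
    using that assms by (intro card_image inj_on_subset[OF inj_on_shift]) auto
  then have "image_mset (\<lambda>b. card (shift j ` b)) A = image_mset card A"
    by (intro image_mset_cong)
  then show ?thesis
    by (simp add: shifted_class_def image_mset.compositionality comp_def)
qed

section \<open>Finite check on the base blocks\<close>

definition block_lists :: "variety list list" where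
  "block_lists =
  [[Inl 1, Inl 10, Inl 16, Inl 18, Inl 37, Inr 2, Inr 20, Inr 36, Inr 32, Inr 33], [Inl 5, Inl 6], [Inl 9, Inl 19], [Inl 39, Inl 14],
   [Inl 8, Inl 26], [Inl 21, Inl 17], [Inl 31, Inl 38], [Inl 23, Inl 11],
   [Inl 4, Inl 34], [Inl 25, Inl 28], [Inl 40, Inl 12], [Inr 10, Inr 12],
   [Inr 18, Inr 38], [Inr 37, Inr 28], [Inr 16, Inr 11], [Inr 1, Inr 34],
   [Inr 21, Inr 35], [Inr 5, Inr 22], [Inr 8, Inr 27], [Inr 9, Inr 15],
   [Inr 39, Inr 24], [Inl 2, Inr 30], [Inl 20, Inr 13], [Inl 36, Inr 7],
   [Inl 32, Inr 29], [Inl 33, Inr 3], [Inl 15, Inr 23], [Inl 27, Inr 25],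
   [Inl 24, Inr 4], [Inl 35, Inr 40], [Inl 22, Inr 31], [Inl 3, Inr 6],
   [Inl 30, Inr 19], [Inl 13, Inr 26], [Inl 7, Inr 14], [Inl 29, Inr 17],
   [Inl 0, Inr 0]]"

lemma base_blocks_eq: "base_blocks = mset (map set block_lists)"
  by (simp add: base_blocks_def block_lists_def)

lemma distinct_block_lists: "\<forall>l \<in> set block_lists. distinct l"
  by (simp add: block_lists_def)

text \<open>Distinctness of \<open>l\<close> makes the product list free of repetitions, so its
  length counts pairs.\<close>

lemma card_pairs_eq_length_filter:
  assumes "distinct l"
  shows "card {(p, q) \<in> set l \<times> set l. P p q} = length (filter (\<lambda>(p, q). P p q) (List.product l l))"
proof -
  have "{(p, q) \<in> set l \<times> set l. P p q} = set (filter (\<lambda>(p, q). P p q) (List.product l l))"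
    by auto
  then show ?thesis
    by (metis assms distinct_card distinct_filter distinct_product)
qed

text \<open>Diagonal pairs are listed too, but give only equal sides with difference 0. The other 10
  * 9 + 36 * 2 = 162 pairs match in number the 2 * 40 + 2 * 41 remaining types.\<close>

definition differences :: "(bool \<times> bool \<times> nat) list" where
  "differences = concat (map (\<lambda>l. map (case_prod difference) (List.product l l)) block_lists)"

lemma sum_base_blocks_eq_count_list:
  "(\<Sum>b \<in># base_blocks. card {(p, q) \<in> b \<times> b. difference p q = d}) = count_list differences d"
proof -
  \<comment> \<open>Stated for any list of distinct lists, so that induction applies.\<close>
  have "(\<Sum>b \<in># mset (map set ls). card {(p, q) \<in> b \<times> b. difference p q = d}) =
      count_list (concat (map (\<lambda>l. map (case_prod difference) (List.product l l)) ls)) d"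
    if "\<forall>l \<in> set ls. distinct l" for ls
    using that
  proof (induction ls)
    case (Cons l ls)
    have "card {(p, q) \<in> set l \<times> set l. difference p q = d} =
        count_list (map (case_prod difference) (List.product l l)) d"
      using card_pairs_eq_length_filter[of l "\<lambda>p q. difference p q = d"] Cons.prems
      by (simp add: count_list_eq_length_filter filter_map comp_def split_def eq_commute[of d])
    with Cons show ?case
      by (simp add: count_list_append)
  qed simp
  then show ?thesis
    by (simp add: base_blocks_eq differences_def distinct_block_lists)
qed

text \<open>A separate function, so that code_simp evaluates the list of differences only once.\<close>

definition each_type_once :: "(bool \<times> bool \<times> nat) list \<Rightarrow> bool" where
  "each_type_once ds \<longleftrightarrow>
    (\<forall>s \<in> set [True, False]. \<forall>t \<in> set [True, False]. \<forall>d \<in> set [0..<41].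
      s \<noteq> t \<or> d \<noteq> 0 \<longrightarrow> count_list ds (s, t, d) = 1)"

lemma each_type_once_differences: "each_type_once differences"
  by code_simp

text \<open>Equal sides with difference 0 would force \<open>x = y\<close>, since values are below
  41; hence the checked types include this one.\<close>

lemma count_difference_of_distinct:
  assumes "x \<in> varieties" "y \<in> varieties" "x \<noteq> y"
  shows "count_list differences (difference x y) = 1"
proof -
  obtain s t d where d: "difference x y = (s, t, d)"
    by (cases "difference x y")
  have "s \<noteq> t \<or> d \<noteq> 0"
    using assms d
    by (cases x; cases y) (auto simp: in_varieties_iff difference_def diff_mod_eq split: if_splits)
  moreover have "d < 41"
    using d by (auto simp: difference_def)
  ultimately show ?thesis
    using each_type_once_differences unfolding d each_type_once_def by (cases s; cases t) auto
qed

lemma parallel_class_base_blocks: "parallel_class varieties base_blocks"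
proof -
  \<comment> \<open>Coverage of all 82 varieties is evaluated on lists and then transferred to
    multisets.\<close>
  have cover: "\<forall>x \<in> set (map Inl [0..<41] @ map Inr [0..<41]).
      length (filter (\<lambda>l. x \<in> set l) block_lists) = 1"
    by code_simp
  have var: "set (map Inl [0..<41] @ map Inr [0..<41]) = varieties"
    by (auto simp: varieties_def)
  have "size {#b \<in># base_blocks. x \<in> b#} = length (filter (\<lambda>l. x \<in> set l) block_lists)" for x
  proof -
    have "size {#b \<in># base_blocks. x \<in> b#} = length (filter ((\<in>) x) (map set block_lists))"
      unfolding base_blocks_eq mset_filter[symmetric] size_mset ..
    then show ?thesis
      by (simp add: filter_map comp_def)
  qed
  then show ?thesis
    using cover unfolding parallel_class_def var
    by (auto simp: base_blocks_def varieties_def)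
qed

lemma card_base_blocks:
  "image_mset card base_blocks = replicate_mset 1 10 + replicate_mset 36 2"
proof -
  have "image_mset card base_blocks = mset (map (\<lambda>l. card (set l)) block_lists)"
    unfolding base_blocks_eq by (simp add: image_mset.compositionality comp_def)
  also have "map (\<lambda>l. card (set l)) block_lists = map length block_lists"
    using distinct_block_lists by (simp add: distinct_card)
  also have "\<dots> = replicate 1 10 @ replicate 36 2"
    by code_simp
  finally show ?thesis
    by (simp only: mset_append mset_replicate)
qed

theorem proposition3p5:
  "card varieties = 82 \<and>
   curd varieties (generated_blocks base_blocks) (generated_classes base_blocks) 1 \<and>
   has_partition_type (generated_classes base_blocks) (replicate_mset 1 10 + replicate_mset 36 2)"
proof -
  have card: "card varieties = 82"
    unfolding varieties_def Plus_def[symmetric] by (simp add: card_Plus)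
  have sub: "\<forall>b \<in># base_blocks. b \<subseteq> varieties"
    using parallel_class_base_blocks by (simp add: parallel_class_def)
  have gen: "\<Sum>\<^sub># (generated_classes base_blocks) = generated_blocks base_blocks"
    by (simp add: generated_classes_def generated_blocks_def sum_unfold_sum_mset)
  have mem: "P \<in># generated_classes base_blocks \<Longrightarrow> \<exists>j. P = shifted_class base_blocks j" for P
    by (auto simp: generated_classes_def)
  have type: "has_partition_type (generated_classes base_blocks)
      (replicate_mset 1 10 + replicate_mset 36 2)"
    unfolding has_partition_type_def
    using mem image_mset_card_shifted_class[OF sub] card_base_blocks by metis
  have "pbd varieties (generated_blocks base_blocks) 1"
    unfolding pbd_def
  proof (intro conjI ballI impI)
    fix b assume "b \<in># generated_blocks base_blocks"
    then show "b \<subseteq> varieties"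
      by (auto simp: generated_blocks_def shifted_class_def set_mset_sum shift_in_varieties)
  next
    fix x y assume "x \<in> varieties" "y \<in> varieties" "x \<noteq> y"
    then show "size {#b \<in># generated_blocks base_blocks. x \<in> b \<and> y \<in> b#} = 1"
      using size_filter_generated_blocks[OF sub] sum_base_blocks_eq_count_list
        count_difference_of_distinct by metis
  qed (rule finite_varieties)
  moreover have "P \<noteq> {#} \<and> parallel_class varieties P" if "P \<in># generated_classes base_blocks" for P
    using mem[OF that] parallel_class_shifted_class[OF parallel_class_base_blocks]
    by (auto simp: shifted_class_def base_blocks_def)
  ultimately have "curd varieties (generated_blocks base_blocks) (generated_classes base_blocks) 1"
    \<comment> \<open>Any two classes have equal block sizes because both have the type in
      \<open>type\<close>.\<close>
    using gen type unfolding curd_def has_partition_type_def by simp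
  with card type show ?thesis
    by blast
qed

end
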